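(* Let $\bar x$ be an optimal solution to the Poisson problem $\min_{x\in\mathbb{R}^n}F_3(x)$. Then for any $R>0$ there is a positive constant $\nu$ such that $$F_3(x)-F_3(\bar x)\ge \nu\, d^2(x;S^* )\quad\mbox{for all}\quad x\in\mathbb{B}_R(\bar x).$$ Consequently, $\partial F_3$ is metrically subregular at $\bar x$ for $0$ with modulus $\nu^{-1}$.
   Context: $A\in\mathbb{R}^{m\times n}_+$ is an $m\times n$ matrix with nonnegative entries and nontrivial (nonzero) rows, and $b\in\mathbb{R}^m_{++}$ is a vector with positive entries. $F_3:\mathbb{R}^n\to\mathbb{R}\cup\{+\infty\}$ is $F_3(x):=h(Ax)+\delta_{\mathbb{R}^n_+}(x)$, where $\delta_{\mathbb{R}^n_+}$ is the indicator function of $\mathbb{R}^n_+$ ($0$ on the set, $+\infty$ outside) and $h$ is the Kullback–Leibler divergence $h(y)=\sum_{i=1}^m\big(b_i\log\frac{b_i}{y_i}+y_i-b_i\big)$ if $y\in\mathbb{R}^m_{++}$, and $h(y)=+\infty$ otherwise. The problem is thus $\min_{x\in\mathbb{R}^n_+}\sum_{i=1}^m \big(b_i\log\frac{b_i}{(Ax)_i}+(Ax)_i-b_i\big)$, and $S^*$ is its set of optimal solutions. $\mathbb{B}_R(\bar x)$ is the closed ball with center $\bar x$ and radius $R$; $d(x;\Omega)$ is the Euclidean distance to $\Omega$ (with $d(x;\emptyset)=\infty$); $\partial$ is the convex subdifferential. A set-valued mapping $G:\mathbb{R}^n\rightrightarrows\mathbb{R}^n$ is metrically subregular at $\bar x$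 for $\bar y\in G(\bar x)$ with modulus $\kappa>0$ if there is a neighborhood $U$ of $\bar x$ with $d(x;G^{-1}(\bar y))\le\kappa\, d(\bar y;G(x))$ for all $x\in U$. *)

theory Defs
  imports "HOL-Analysis.Analysis"
begin

text \<open>The infimum is taken in the extended reals, so the distance to the empty set is
  \<open>\<infinity>\<close>; the library's \<open>infdist\<close> is \<open>0\<close> there.\<close>

definition set_distance :: "'a::metric_space \<Rightarrow> 'a set \<Rightarrow> ereal" where
  "set_distance x \<Omega> = (INF y\<in>\<Omega>. ereal (dist x y))"

definition argmin_set :: "('a \<Rightarrow> ereal) \<Rightarrow> 'a set" where
  "argmin_set f = {x. is_arg_min f (\<lambda>_. True) x}"

definition convex_indicator :: "'a set \<Rightarrow> 'a \<Rightarrow> ereal" where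
  "convex_indicator S x = (if x \<in> S then 0 else \<infinity>)"

text \<open>As usual in convex analysis, the subdifferential is empty at points where the function
  is not finite.\<close>

definition subdifferential :: "('a::real_inner \<Rightarrow> ereal) \<Rightarrow> 'a \<Rightarrow> 'a set" where
  "subdifferential f x =
     {v. \<bar>f x\<bar> \<noteq> \<infinity> \<and> (\<forall>y. f x + ereal (v \<bullet> (y - x)) \<le> f y)}"

definition metrically_subregular ::
  "('a::metric_space \<Rightarrow> 'b::metric_space set) \<Rightarrow> 'a \<Rightarrow> 'b \<Rightarrow> real \<Rightarrow> bool" where
  "metrically_subregular G xbar ybar \<kappa> \<longleftrightarrow>
     ybar \<in> G xbar \<and> \<kappa> > 0 \<and>
     (\<exists>U. open U \<and> xbar \<in> U \<and>
        (\<forall>x\<in>U. set_distance x {z. ybar \<in> G z} \<le> ereal \<kappa> * set_distance ybar (G x)))"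

definition nonneg_orthant :: "(real ^ 'n) set" where
  "nonneg_orthant = {x. \<forall>j. 0 \<le> x $ j}"

definition kl_divergence :: "real ^ 'm \<Rightarrow> real ^ 'm \<Rightarrow> ereal" where
  "kl_divergence b y =
     (if \<forall>i. 0 < y $ i
      then ereal (\<Sum>i\<in>UNIV. b $ i * ln (b $ i / y $ i) + y $ i - b $ i)
      else \<infinity>)"

definition poisson_objective :: "real ^ 'n ^ 'm \<Rightarrow> real ^ 'm \<Rightarrow> real ^ 'n \<Rightarrow> ereal" where
  "poisson_objective A b x = kl_divergence b (A *v x) + convex_indicator nonneg_orthant x"

end

theory Submission
  imports Defs
begin

text \<open>
  Two facts give the quadratic growth. The first is a midpoint form of strict convexity of the
  divergence: since \<open>xbar\<close> is a minimiser and the midpoint of \<open>x\<close> and \<open>xbar\<close> is again feasible,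
  its objective value is at least the minimum, and convexity with its quantitative gap
  (\<open>kl_divergence_midpoint\<close>) turns this into a lower bound for \<open>F x - F xbar\<close> by the sum of
  \<open>b\<^sub>i ((u\<^sub>i - v\<^sub>i) / (u\<^sub>i + v\<^sub>i))\<^sup>2\<close>, where \<open>u = A x\<close> and \<open>v = A xbar\<close>. On a ball the
  denominators are bounded, so this dominates a multiple of \<open>\<parallel>A x - A xbar\<parallel>\<^sup>2\<close>.

  The second is a Hoffman error bound (\<open>hoffman_conformal\<close>). Every \<open>w \<ge> 0\<close> with \<open>A w = A xbar\<close>
  is optimal, because the objective sees a feasible point only through its image under \<open>A\<close>.
  From a feasible \<open>x\<close>, such a \<open>w\<close> is reached by a step whose length is at most a constant times
  \<open>\<parallel>A x - A xbar\<parallel>\<close>: strip from \<open>xbar - x\<close> all components in the kernel of \<open>A\<close> that agree with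
  it in sign. What remains lies in one of finitely many closed sign cones on which \<open>A\<close> is
  injective at \<open>0\<close>, hence bounded below, and each coordinate of the new point stays between those
  of \<open>x\<close> and \<open>xbar\<close>, hence nonnegative.

  Metric subregularity then follows from growth for any extended real function: for \<open>v\<close> in the
  subdifferential at \<open>x\<close> and \<open>z\<close> optimal, the subgradient inequality gives
  \<open>\<nu> d\<^sup>2 \<le> f x - f z \<le> \<parallel>v\<parallel> \<parallel>x - z\<parallel>\<close>, and taking the infimum over \<open>z\<close> allows cancelling one
  factor \<open>d\<close>.
\<close>

section \<open>A Hoffman bound by conformal vectors\<close>

text \<open>By homogeneity only the unit vectors of the cone matter, and there compactness gives a positive minimum of
  \<open>\<parallel>A v\<parallel>\<close>.\<close>

lemma bounded_below_on_closed_cone: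
  fixes A :: "real ^ 'n ^ 'm" and C :: "(real ^ 'n) set"
  assumes "closed C" and cone: "\<And>v t. v \<in> C \<Longrightarrow> t \<ge> 0 \<Longrightarrow> t *\<^sub>R v \<in> C"
    and ker: "\<And>v. v \<in> C \<Longrightarrow> A *v v = 0 \<Longrightarrow> v = 0"
  obtains c where "c > 0" "\<And>v. v \<in> C \<Longrightarrow> norm v \<le> c * norm (A *v v)"
proof (cases "C \<inter> sphere 0 1 = {}")
  case True
  have "norm v \<le> 1 * norm (A *v v)" if "v \<in> C" for v
  proof (cases "v = 0")
    case False
    then have "(1 / norm v) *\<^sub>R v \<in> C \<inter> sphere 0 1"
      using cone[OF that, of "1 / norm v"] by simp
    with True show ?thesis by blast
  qed simp
  then show ?thesis using that[of 1] by simp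
next
  case False
  have "compact (C \<inter> sphere 0 1)"
    using \<open>closed C\<close> by (simp add: closed_Int_compact)
  moreover have "continuous_on (C \<inter> sphere 0 1) (\<lambda>v. norm (A *v v))"
    by (intro continuous_intros)
  ultimately obtain e where e: "e \<in> C \<inter> sphere 0 1"
    and emin: "\<And>v. v \<in> C \<inter> sphere 0 1 \<Longrightarrow> norm (A *v e) \<le> norm (A *v v)"
    using continuous_attains_inf[OF _ False] by blast
  have pos: "norm (A *v e) > 0"
    using e ker[of e] by auto
  have "norm v \<le> inverse (norm (A *v e)) * norm (A *v v)" if "v \<in> C" for v
  proof (cases "v = 0")
    case False
    then have "(1 / norm v) *\<^sub>R v \<in> C \<inter> sphere 0 1"
      using cone[OF that, of "1 / norm v"] by simp
    from emin[OF this] have "norm (A *v e) \<le> norm (A *v v) / norm v"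
      by (simp add: matrix_vector_mult_scaleR)
    then have "norm (A *v e) * norm v \<le> norm (A *v v)"
      using False by (simp add: field_simps)
    then show ?thesis using pos by (simp add: field_simps)
  qed simp
  then show ?thesis using that[of "inverse (norm (A *v e))"] pos by simp
qed

definition sign_cone :: "'n set \<Rightarrow> 'n set \<Rightarrow> (real ^ 'n) set" where
  "sign_cone P N = {v. \<forall>j. (j \<notin> P \<longrightarrow> v $ j \<le> 0) \<and> (j \<notin> N \<longrightarrow> 0 \<le> v $ j)}"

lemma closed_sign_cone: "closed (sign_cone P N)"
  unfolding sign_cone_def
  by (intro closed_Collect_all closed_Collect_conj closed_Collect_imp open_Collect_const
      closed_Collect_le continuous_intros)

text \<open>The index pairs of sign cones form a finite type, so one constant serves all those cones on
  which \<open>A\<close> is injective at \<open>0\<close>.\<close>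

lemma uniform_bound_on_sign_cones:
  fixes A :: "real ^ 'n ^ 'm"
  obtains c where "c > 0"
    "\<And>P N v. (\<And>k. k \<in> sign_cone P N \<Longrightarrow> A *v k = 0 \<Longrightarrow> k = 0) \<Longrightarrow> v \<in> sign_cone P N
       \<Longrightarrow> norm v \<le> c * norm (A *v v)"
proof -
  define good where
    "good PN \<longleftrightarrow> (\<forall>k \<in> sign_cone (fst PN) (snd PN). A *v k = 0 \<longrightarrow> k = 0)" for PN
  have "\<exists>c>0. good PN \<longrightarrow> (\<forall>v \<in> sign_cone (fst PN) (snd PN). norm v \<le> c * norm (A *v v))" for PN
  proof (cases "good PN")
    case True
    have "t *\<^sub>R v \<in> sign_cone P N" if "v \<in> sign_cone P N" "t \<ge> 0" for v :: "real ^ 'n" and t P N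
      using that by (auto simp: sign_cone_def mult_nonneg_nonpos)
    then show ?thesis
      using bounded_below_on_closed_cone[OF closed_sign_cone, of "fst PN" "snd PN" A] True
      unfolding good_def by metis
  qed (auto intro: exI[of _ 1])
  then obtain c where cpos: "\<And>PN. c PN > 0"
    and c: "\<And>PN v. good PN \<Longrightarrow> v \<in> sign_cone (fst PN) (snd PN) \<Longrightarrow> norm v \<le> c PN * norm (A *v v)"
    by metis
  define m where "m = Max (range c)"
  have le: "c PN \<le> m" for PN
    unfolding m_def by (intro Max_ge) auto
  show thesis
  proof (rule that[of m])
    show "m > 0" using less_le_trans[OF cpos le] .
    fix P N and v :: "real ^ 'n"
    assume "\<And>k. k \<in> sign_cone P N \<Longrightarrow> A *v k = 0 \<Longrightarrow> k = 0" "v \<in> sign_cone P N"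
    then have "norm v \<le> c (P, N) * norm (A *v v)"
      by (intro c) (auto simp: good_def)
    also have "\<dots> \<le> m * norm (A *v v)"
      by (intro mult_right_mono le) auto
    finally show "norm v \<le> m * norm (A *v v)" .
  qed
qed

text \<open>A vector \<open>k\<close> in the sign cone spanned by the pattern of \<open>v\<close> has its support in that of \<open>v\<close>
  and the same signs, so subtracting a small multiple of it shrinks \<open>v\<close> coordinatewise towards
  \<open>0\<close>.\<close>

lemma conformal_shrink:
  fixes v k :: "real ^ 'n"
  assumes k: "k \<in> sign_cone {j. v $ j > 0} {j. v $ j < 0}" and "k \<noteq> 0"
  obtains t where "\<And>j. min 0 (v $ j) \<le> (v - t *\<^sub>R k) $ j \<and> (v - t *\<^sub>R k) $ j \<le> max 0 (v $ j)"
    and "(\<Sum>j\<in>UNIV. \<bar>(v - t *\<^sub>R k) $ j\<bar>) < (\<Sum>j\<in>UNIV. \<bar>v $ j\<bar>)"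
proof -
  define r where "r j = (if k $ j = 0 then 1 else v $ j / k $ j)" for j
  define t where "t = Min (range r)"
  have sgn: "k $ j > 0 \<Longrightarrow> v $ j > 0" "k $ j < 0 \<Longrightarrow> v $ j < 0" for j
    using k by (fastforce simp: sign_cone_def)+
  have "r j > 0" for j
    unfolding r_def using sgn[of j]
    by (cases "k $ j" "0 :: real" rule: linorder_cases) (auto simp: divide_neg_neg)
  then have t: "t > 0"
    unfolding t_def by (subst Min_gr_iff) auto
  have tle: "t \<le> r j" for j
    unfolding t_def by (intro Min_le) auto
  have pos: "0 < t * k $ j \<and> t * k $ j \<le> v $ j" if "k $ j > 0" for j
    using that t tle[of j] by (auto simp: r_def field_simps)
  have neg: "t * k $ j < 0 \<and> v $ j \<le> t * k $ j" if "k $ j < 0" for j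
    using that t tle[of j] by (auto simp: r_def field_simps mult_pos_neg)
  have shrink: "\<bar>(v - t *\<^sub>R k) $ j\<bar> \<le> \<bar>v $ j\<bar>" for j
    using pos[of j] neg[of j] by (cases "k $ j" "0 :: real" rule: linorder_cases) auto
  show thesis
  proof (rule that[of t])
    show "min 0 (v $ j) \<le> (v - t *\<^sub>R k) $ j \<and> (v - t *\<^sub>R k) $ j \<le> max 0 (v $ j)" for j
      using pos[of j] neg[of j] by (cases "k $ j" "0 :: real" rule: linorder_cases) auto
    obtain i where "k $ i \<noteq> 0"
      using \<open>k \<noteq> 0\<close> by (auto simp: vec_eq_iff)
    then have "\<bar>(v - t *\<^sub>R k) $ i\<bar> < \<bar>v $ i\<bar>"
      using pos[of i] neg[of i] by (cases "k $ i" "0 :: real" rule: linorder_cases) auto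
    then show "(\<Sum>j\<in>UNIV. \<bar>(v - t *\<^sub>R k) $ j\<bar>) < (\<Sum>j\<in>UNIV. \<bar>v $ j\<bar>)"
      using shrink by (intro sum_strict_mono_ex1) auto
  qed
qed

text \<open>Among the vectors with image \<open>A d\<close> lying coordinatewise between \<open>0\<close> and \<open>d\<close>, one of least
  \<open>\<ell>\<^sup>1\<close>-norm admits no further shrinking, so its sign cone meets the kernel of \<open>A\<close> only in \<open>0\<close> and
  the uniform constant applies to it.\<close>

lemma hoffman_conformal:
  fixes A :: "real ^ 'n ^ 'm"
  obtains c where "c > 0"
    "\<And>d. \<exists>v. A *v v = A *v d \<and> (\<forall>j. min 0 (d $ j) \<le> v $ j \<and> v $ j \<le> max 0 (d $ j))
          \<and> norm v \<le> c * norm (A *v d)"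
proof -
  obtain c where "c > 0" and c:
    "\<And>P N v. (\<And>k. k \<in> sign_cone P N \<Longrightarrow> A *v k = 0 \<Longrightarrow> k = 0) \<Longrightarrow> v \<in> sign_cone P N
       \<Longrightarrow> norm v \<le> c * norm (A *v v)"
    using uniform_bound_on_sign_cones[of A] by blast
  have "\<exists>v. A *v v = A *v d \<and> (\<forall>j. min 0 (d $ j) \<le> v $ j \<and> v $ j \<le> max 0 (d $ j))
          \<and> norm v \<le> c * norm (A *v d)" for d
  proof -
    define K where "K = {v. A *v v = A *v d} \<inter> cbox (\<chi> j. min 0 (d $ j)) (\<chi> j. max 0 (d $ j))"
    have memK: "v \<in> K \<longleftrightarrow>
        A *v v = A *v d \<and> (\<forall>j. min 0 (d $ j) \<le> v $ j \<and> v $ j \<le> max 0 (d $ j))" for v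
      unfolding K_def by (simp add: mem_box_cart)
    have "closed {v. A *v v = A *v d}"
      by (intro closed_Collect_eq continuous_intros)
    then have "compact K"
      unfolding K_def by (intro closed_Int_compact compact_cbox)
    moreover have "d \<in> K"
      unfolding memK by auto
    moreover have "continuous_on K (\<lambda>v. \<Sum>j\<in>UNIV. \<bar>v $ j\<bar>)"
      by (intro continuous_intros)
    ultimately obtain v where "v \<in> K"
      and vmin: "\<And>w. w \<in> K \<Longrightarrow> (\<Sum>j\<in>UNIV. \<bar>v $ j\<bar>) \<le> (\<Sum>j\<in>UNIV. \<bar>w $ j\<bar>)"
      using continuous_attains_inf[of K] by blast
    have "k = 0" if k: "k \<in> sign_cone {j. v $ j > 0} {j. v $ j < 0}" "A *v k = 0" for k
    proof (rule ccontr)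
      assume "k \<noteq> 0"
      then obtain t where
        t: "\<And>j. min 0 (v $ j) \<le> (v - t *\<^sub>R k) $ j \<and> (v - t *\<^sub>R k) $ j \<le> max 0 (v $ j)"
        and less: "(\<Sum>j\<in>UNIV. \<bar>(v - t *\<^sub>R k) $ j\<bar>) < (\<Sum>j\<in>UNIV. \<bar>v $ j\<bar>)"
        using conformal_shrink[OF k(1)] by blast
      have "A *v (v - t *\<^sub>R k) = A *v d"
        using \<open>v \<in> K\<close> k(2) by (simp add: memK matrix_vector_mult_diff_distrib matrix_vector_mult_scaleR)
      moreover have "min 0 (d $ j) \<le> (v - t *\<^sub>R k) $ j \<and> (v - t *\<^sub>R k) $ j \<le> max 0 (d $ j)" for j
      proof -
        have "min 0 (d $ j) \<le> v $ j \<and> v $ j \<le> max 0 (d $ j)"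
          using \<open>v \<in> K\<close> by (simp add: memK)
        with t[of j] show ?thesis by linarith
      qed
      ultimately have "v - t *\<^sub>R k \<in> K"
        unfolding memK by blast
      from vmin[OF this] less show False by linarith
    qed
    moreover have "v \<in> sign_cone {j. v $ j > 0} {j. v $ j < 0}"
      by (auto simp: sign_cone_def)
    ultimately have "norm v \<le> c * norm (A *v v)"
      by (rule c)
    with \<open>v \<in> K\<close> show ?thesis
      unfolding memK by metis
  qed
  with \<open>c > 0\<close> that show thesis by blast
qed

section \<open>Quantitative midpoint convexity of the divergence\<close>

text \<open>With \<open>m\<close> the arithmetic mean, \<open>u v / m\<^sup>2 = 1 - ((u - v) / (u + v))\<^sup>2\<close>; the gap is
  \<open>ln s \<le> s - 1\<close> at this value.\<close>

lemma ln_midpoint_gap: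
  fixes u v :: real
  assumes "u > 0" "v > 0"
  shows "ln u + ln v + ((u - v) / (u + v))\<^sup>2 \<le> 2 * ln ((u + v) / 2)"
proof -
  define m where "m = (u + v) / 2"
  have m: "m > 0" using assms by (simp add: m_def)
  have "ln (u * v / m\<^sup>2) \<le> u * v / m\<^sup>2 - 1"
    using assms m by (intro ln_le_minus_one) simp
  moreover have "ln (u * v / m\<^sup>2) = ln u + ln v - 2 * ln m"
    using assms m by (simp add: ln_div ln_mult ln_realpow)
  moreover have "u * v / m\<^sup>2 - 1 = - ((u - v) / (u + v))\<^sup>2"
  proof -
    have "u * v / m\<^sup>2 - 1 = (u * v - m\<^sup>2) / m\<^sup>2"
      using m by (simp add: diff_divide_distrib)
    also have "u * v - m\<^sup>2 = - ((u - v) / 2)\<^sup>2"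
      by (simp add: m_def power2_eq_square field_simps)
    also have "- ((u - v) / 2)\<^sup>2 / m\<^sup>2 = - ((u - v) / 2 / m)\<^sup>2"
      by (simp only: power_divide[of _ m] minus_divide_left)
    also have "(u - v) / 2 / m = (u - v) / (u + v)"
      unfolding m_def using assms by (simp add: divide_simps) (simp add: algebra_simps)
    finally show ?thesis .
  qed
  ultimately show ?thesis by (simp add: m_def)
qed

lemma kl_divergence_midpoint:
  fixes b y z :: "real ^ 'm"
  assumes b: "\<forall>i. 0 < b $ i" and y: "\<forall>i. 0 < y $ i" and z: "\<forall>i. 0 < z $ i"
  shows "2 * kl_divergence b (midpoint y z)
           + ereal (\<Sum>i\<in>UNIV. b $ i * ((y $ i - z $ i) / (y $ i + z $ i))\<^sup>2)
         \<le> kl_divergence b y + kl_divergence b z"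
proof -
  have mid: "midpoint y z $ i = (y $ i + z $ i) / 2" for i
    by (simp add: midpoint_def)
  have mpos: "0 < midpoint y z $ i" for i
    using y z by (simp add: mid add_pos_pos)
  have "2 * (b $ i * ln (b $ i / midpoint y z $ i) + midpoint y z $ i - b $ i)
          + b $ i * ((y $ i - z $ i) / (y $ i + z $ i))\<^sup>2
        \<le> (b $ i * ln (b $ i / y $ i) + y $ i - b $ i)
          + (b $ i * ln (b $ i / z $ i) + z $ i - b $ i)" for i
  proof -
    have ln_quot: "ln (b $ i / s) = ln (b $ i) - ln s" if "s > 0" for s
      using b[rule_format, of i] that by (simp add: ln_div)
    have "b $ i * (ln (y $ i) + ln (z $ i) + ((y $ i - z $ i) / (y $ i + z $ i))\<^sup>2)
          \<le> b $ i * (2 * ln (midpoint y z $ i))"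
      unfolding mid using b y z by (intro mult_left_mono ln_midpoint_gap) (auto simp: less_imp_le)
    moreover have "2 * midpoint y z $ i = y $ i + z $ i"
      by (simp add: mid)
    moreover have "0 < y $ i" "0 < z $ i"
      using y z by auto
    ultimately show ?thesis
      unfolding ln_quot[OF mpos] ln_quot[OF \<open>0 < y $ i\<close>] ln_quot[OF \<open>0 < z $ i\<close>]
      by (simp add: algebra_simps)
  qed
  then have "(\<Sum>i\<in>UNIV. 2 * (b $ i * ln (b $ i / midpoint y z $ i) + midpoint y z $ i - b $ i)
          + b $ i * ((y $ i - z $ i) / (y $ i + z $ i))\<^sup>2)
        \<le> (\<Sum>i\<in>UNIV. (b $ i * ln (b $ i / y $ i) + y $ i - b $ i)
          + (b $ i * ln (b $ i / z $ i) + z $ i - b $ i))"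
    by (rule sum_mono)
  then have "2 * (\<Sum>i\<in>UNIV. b $ i * ln (b $ i / midpoint y z $ i) + midpoint y z $ i - b $ i)
          + (\<Sum>i\<in>UNIV. b $ i * ((y $ i - z $ i) / (y $ i + z $ i))\<^sup>2)
        \<le> (\<Sum>i\<in>UNIV. b $ i * ln (b $ i / y $ i) + y $ i - b $ i)
          + (\<Sum>i\<in>UNIV. b $ i * ln (b $ i / z $ i) + z $ i - b $ i)"
    by (simp only: sum.distrib sum_distrib_left)
  moreover have "kl_divergence b y = ereal (\<Sum>i\<in>UNIV. b $ i * ln (b $ i / y $ i) + y $ i - b $ i)"
    and "kl_divergence b z = ereal (\<Sum>i\<in>UNIV. b $ i * ln (b $ i / z $ i) + z $ i - b $ i)"
    and "kl_divergence b (midpoint y z) =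
      ereal (\<Sum>i\<in>UNIV. b $ i * ln (b $ i / midpoint y z $ i) + midpoint y z $ i - b $ i)"
    using y z mpos by (simp_all add: kl_divergence_def)
  ultimately show ?thesis
    by (simp add: numeral_eq_ereal)
qed

section \<open>Distances and minimisers\<close>

lemma set_distance_eq_infdist:
  assumes "S \<noteq> {}"
  shows "set_distance x S = ereal (infdist x S)"
proof -
  have "bdd_below ((\<lambda>y. dist x y) ` S)"
    by (rule bdd_belowI[of _ 0]) auto
  then have "ereal (INF y\<in>S. dist x y) = (INF y\<in>S. ereal (dist x y))"
    using assms by (subst ereal_Inf') (auto simp: image_image)
  then show ?thesis
    using assms by (simp add: set_distance_def infdist_def)
qed

lemma argmin_set_iff: "x \<in> argmin_set f \<longleftrightarrow> (\<forall>y. f x \<le> f y)"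
  by (auto simp: argmin_set_def is_arg_min_def not_less)

lemma zero_in_subdifferential_iff:
  assumes "xbar \<in> argmin_set f" "\<bar>f xbar\<bar> \<noteq> \<infinity>"
  shows "0 \<in> subdifferential f z \<longleftrightarrow> z \<in> argmin_set f"
proof -
  have "f z = f xbar" if "z \<in> argmin_set f"
    using that assms(1) by (meson antisym argmin_set_iff)
  with assms(2) show ?thesis
    by (auto simp: subdifferential_def argmin_set_iff simp flip: zero_ereal_def)
qed

text \<open>Growth bounds \<open>\<nu> d\<^sup>2\<close> by \<open>f x - f z\<close>, and a subgradient \<open>v\<close> at \<open>x\<close> bounds that gap by
  \<open>\<parallel>v\<parallel> \<parallel>x - z\<parallel>\<close> for every minimiser \<open>z\<close>. Where the subdifferential is empty, its distance to
  \<open>0\<close> is infinite.\<close>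

lemma quadratic_growth_imp_metrically_subregular:
  fixes f :: "'a::real_inner \<Rightarrow> ereal"
  assumes opt: "xbar \<in> argmin_set f" and fin: "\<bar>f xbar\<bar> \<noteq> \<infinity>" and "\<nu> > 0" "R > 0"
    and growth: "\<And>x. x \<in> cball xbar R \<Longrightarrow>
                   ereal \<nu> * (set_distance x (argmin_set f))\<^sup>2 \<le> f x - f xbar"
  shows "metrically_subregular (subdifferential f) xbar 0 (inverse \<nu>)"
proof -
  let ?S = "argmin_set f"
  have ne: "?S \<noteq> {}" using opt by blast
  have bound: "ereal (\<nu> * infdist x ?S) \<le> ereal (norm v)"
    if x: "x \<in> ball xbar R" and v: "v \<in> subdifferential f x" for x v
  proof -
    let ?d = "infdist x ?S"
    obtain p where p: "f x = ereal p"
      using v by (cases "f x") (auto simp: subdifferential_def)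
    obtain q where q: "f xbar = ereal q"
      using fin by (cases "f xbar") auto
    have gr: "\<nu> * ?d\<^sup>2 \<le> p - q"
      using growth[of x] x by (simp add: set_distance_eq_infdist[OF ne] p q)
    have le: "\<nu> * ?d\<^sup>2 \<le> norm v * dist x z" if "z \<in> ?S" for z
    proof -
      have "f z = f xbar"
        using that opt by (meson antisym argmin_set_iff)
      moreover have "f x + ereal (v \<bullet> (z - x)) \<le> f z"
        using v by (simp add: subdifferential_def)
      ultimately have "p - q \<le> v \<bullet> (x - z)"
        by (simp add: p q inner_diff_right)
      also have "\<dots> \<le> norm v * norm (x - z)"
        by (rule norm_cauchy_schwarz)
      finally show ?thesis
        using gr by (simp add: dist_norm)
    qed
    have "\<nu> * ?d\<^sup>2 \<le> norm v * ?d"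
    proof (cases "v = 0")
      case True
      then show ?thesis using le[OF opt] by simp
    next
      case False
      have "\<nu> * ?d\<^sup>2 / norm v \<le> ?d"
        unfolding infdist_notempty[OF ne, of x]
        using le[unfolded infdist_notempty[OF ne, of x]] False ne
        by (intro cINF_greatest) (auto simp: field_simps)
      then show ?thesis using False by (simp add: field_simps)
    qed
    then have "\<nu> * ?d \<le> norm v"
      using infdist_nonneg[of x ?S] by (cases "?d = 0") (auto simp: power2_eq_square)
    then show ?thesis by simp
  qed
  have "set_distance x {z. 0 \<in> subdifferential f z}
          \<le> ereal (inverse \<nu>) * set_distance 0 (subdifferential f x)"
    if x: "x \<in> ball xbar R" for x
  proof -
    have "ereal (\<nu> * infdist x ?S) \<le> set_distance 0 (subdifferential f x)"
      unfolding set_distance_def using bound[OF x] by (intro INF_greatest) simp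
    then have "ereal (inverse \<nu>) * ereal (\<nu> * infdist x ?S)
                 \<le> ereal (inverse \<nu>) * set_distance 0 (subdifferential f x)"
      using \<open>\<nu> > 0\<close> by (intro ereal_mult_left_mono) auto
    moreover have "inverse \<nu> * (\<nu> * infdist x ?S) = infdist x ?S"
      using \<open>\<nu> > 0\<close> by simp
    ultimately show ?thesis
      by (simp add: zero_in_subdifferential_iff[OF opt fin] set_distance_eq_infdist[OF ne])
  qed
  then show ?thesis
    unfolding metrically_subregular_def
    using \<open>\<nu> > 0\<close> \<open>R > 0\<close> opt zero_in_subdifferential_iff[OF opt fin]
    by (auto intro!: exI[of _ "ball xbar R"])
qed

section \<open>The Poisson problem\<close>

lemma poisson_objective_finite_iff:
  "\<bar>poisson_objective A b x\<bar> \<noteq> \<infinity> \<longleftrightarrow> x \<in> nonneg_orthant \<and> (\<forall>i. 0 < (A *v x) $ i)"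
  by (simp add: poisson_objective_def kl_divergence_def convex_indicator_def)

lemma poisson_objective_nonneg_orthant:
  "x \<in> nonneg_orthant \<Longrightarrow> poisson_objective A b x = kl_divergence b (A *v x)"
  by (simp add: poisson_objective_def convex_indicator_def)

lemma poisson_objective_infinite:
  "\<not> (x \<in> nonneg_orthant \<and> (\<forall>i. 0 < (A *v x) $ i)) \<Longrightarrow> poisson_objective A b x = \<infinity>"
  by (auto simp: poisson_objective_def kl_divergence_def convex_indicator_def)

text \<open>The all-ones vector has a positive image because no row of \<open>A\<close> vanishes, so the minimum is
  finite.\<close>

lemma poisson_minimum_finite:
  fixes A :: "real ^ 'n ^ 'm"
  assumes nonneg: "\<forall>i j. 0 \<le> A $ i $ j" and rows: "\<forall>i. row i A \<noteq> 0"
    and opt: "xbar \<in> argmin_set (poisson_objective A b)"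
  shows "xbar \<in> nonneg_orthant" "0 < (A *v xbar) $ i"
proof -
  let ?e = "(\<chi> j. 1) :: real ^ 'n"
  have "0 < (A *v ?e) $ i" for i
  proof -
    obtain j where "A $ i $ j \<noteq> 0"
      using rows by (force simp: row_def vec_eq_iff)
    then have "0 < (\<Sum>j\<in>UNIV. A $ i $ j)"
      using nonneg by (intro sum_pos2[of _ j]) (auto simp: less_le)
    then show ?thesis by (simp add: matrix_vector_mult_def)
  qed
  then have "\<bar>poisson_objective A b ?e\<bar> \<noteq> \<infinity>"
    unfolding poisson_objective_finite_iff by (simp add: nonneg_orthant_def)
  moreover have "poisson_objective A b xbar \<le> poisson_objective A b ?e"
    using opt by (simp add: argmin_set_iff)
  ultimately have "poisson_objective A b xbar \<noteq> \<infinity>"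
    by auto
  then show "xbar \<in> nonneg_orthant" "0 < (A *v xbar) $ i"
    using poisson_objective_infinite by blast+
qed

text \<open>The midpoint of \<open>x\<close> and \<open>xbar\<close> is feasible and cannot beat \<open>xbar\<close>, so the convexity gap
  at the midpoint is paid for by \<open>x\<close>.\<close>

lemma poisson_image_growth:
  fixes A :: "real ^ 'n ^ 'm" and x xbar :: "real ^ 'n"
  defines "u \<equiv> A *v x" and "v \<equiv> A *v xbar"
  assumes b: "\<forall>i. 0 < b $ i" and opt: "xbar \<in> argmin_set (poisson_objective A b)"
    and xbar: "xbar \<in> nonneg_orthant" "\<forall>i. 0 < v $ i"
    and x: "x \<in> nonneg_orthant" "\<forall>i. 0 < u $ i"
  shows "ereal (\<Sum>i\<in>UNIV. b $ i * ((u $ i - v $ i) / (u $ i + v $ i))\<^sup>2)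
           \<le> poisson_objective A b x - poisson_objective A b xbar"
proof -
  have mid: "midpoint x xbar \<in> nonneg_orthant"
    using x(1) xbar(1) by (simp add: nonneg_orthant_def midpoint_def)
  have Amid: "A *v midpoint x xbar = midpoint u v"
    by (simp add: midpoint_def u_def v_def matrix_vector_mult_scaleR matrix_vector_right_distrib)
  have mpos: "0 < midpoint u v $ i" for i
    using x(2) xbar(2) by (simp add: midpoint_def add_pos_pos)
  obtain p q r where p: "kl_divergence b u = ereal p" and q: "kl_divergence b v = ereal q"
    and r: "kl_divergence b (midpoint u v) = ereal r"
    using x(2) xbar(2) mpos by (simp add: kl_divergence_def)
  have "poisson_objective A b xbar \<le> poisson_objective A b (midpoint x xbar)"
    using opt by (simp add: argmin_set_iff)
  then have "q \<le> r"
    using xbar(1) mid q r by (simp add: poisson_objective_nonneg_orthant Amid v_def)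
  moreover have "2 * r + (\<Sum>i\<in>UNIV. b $ i * ((u $ i - v $ i) / (u $ i + v $ i))\<^sup>2) \<le> p + q"
    using kl_divergence_midpoint[OF b x(2) xbar(2)] by (simp add: p q r numeral_eq_ereal)
  ultimately show ?thesis
    using x(1) xbar(1) p q by (simp add: poisson_objective_nonneg_orthant u_def v_def)
qed

text \<open>The point \<open>w\<close> supplied by the Hoffman bound satisfies \<open>A w = A xbar\<close> and \<open>w \<ge> 0\<close>, so it
  has the optimal value.\<close>

lemma poisson_error_bound:
  fixes A :: "real ^ 'n ^ 'm"
  assumes opt: "xbar \<in> argmin_set (poisson_objective A b)" and xbar: "xbar \<in> nonneg_orthant"
  obtains c where "c > 0"
    "\<And>x. x \<in> nonneg_orthant \<Longrightarrow>
       infdist x (argmin_set (poisson_objective A b)) \<le> c * norm (A *v x - A *v xbar)"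
proof -
  obtain c where "c > 0" and c:
    "\<And>d. \<exists>v. A *v v = A *v d \<and> (\<forall>j. min 0 (d $ j) \<le> v $ j \<and> v $ j \<le> max 0 (d $ j))
          \<and> norm v \<le> c * norm (A *v d)"
    using hoffman_conformal[of A] by blast
  have "infdist x (argmin_set (poisson_objective A b)) \<le> c * norm (A *v x - A *v xbar)"
    if x: "x \<in> nonneg_orthant" for x
  proof -
    obtain v where v: "A *v v = A *v (xbar - x)" "norm v \<le> c * norm (A *v (xbar - x))"
      and box: "\<And>j. min 0 ((xbar - x) $ j) \<le> v $ j"
      using c[of "xbar - x"] by blast
    have "0 \<le> (x + v) $ j" for j
    proof -
      have "0 \<le> x $ j" "0 \<le> xbar $ j"
        using x xbar by (auto simp: nonneg_orthant_def)
      with box[of j] show ?thesis by (simp add: min_def split: if_splits)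
    qed
    then have "x + v \<in> nonneg_orthant"
      by (simp add: nonneg_orthant_def)
    moreover have "A *v (x + v) = A *v xbar"
      using v(1) by (simp add: matrix_vector_right_distrib matrix_vector_mult_diff_distrib)
    ultimately have "poisson_objective A b (x + v) = poisson_objective A b xbar"
      using xbar by (simp add: poisson_objective_nonneg_orthant)
    then have "x + v \<in> argmin_set (poisson_objective A b)"
      using opt by (simp add: argmin_set_iff)
    then have "infdist x (argmin_set (poisson_objective A b)) \<le> dist x (x + v)"
      by (rule infdist_le)
    also have "\<dots> \<le> c * norm (A *v x - A *v xbar)"
      using v(2) by (simp add: dist_norm matrix_vector_mult_diff_distrib norm_minus_commute)
    finally show ?thesis .
  qed
  with \<open>c > 0\<close> that show thesis by blast
qed

theorem lemma5p1:
  fixes A :: "real ^ 'n ^ 'm" and b :: "real ^ 'm" and xbar :: "real ^ 'n" and R :: real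
  assumes "\<forall>i j. 0 \<le> A $ i $ j"
    and "\<forall>i. row i A \<noteq> 0"
    and "\<forall>i. 0 < b $ i"
    and "xbar \<in> argmin_set (poisson_objective A b)"
    and "R > 0"
  shows "\<exists>\<nu>>0.
      (\<forall>x\<in>cball xbar R.
         poisson_objective A b x - poisson_objective A b xbar
           \<ge> ereal \<nu> * (set_distance x (argmin_set (poisson_objective A b)))\<^sup>2) \<and>
      metrically_subregular (subdifferential (poisson_objective A b)) xbar 0 (inverse \<nu>)"
proof -
  let ?F = "poisson_objective A b"
  let ?S = "argmin_set ?F"
  note opt = assms(4)
  have feas: "xbar \<in> nonneg_orthant" "\<forall>i. 0 < (A *v xbar) $ i"
    using poisson_minimum_finite[OF assms(1,2) opt] by blast+
  then have fin: "\<bar>?F xbar\<bar> \<noteq> \<infinity>"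
    by (simp add: poisson_objective_finite_iff)
  obtain c where c: "c > 0"
    "\<And>x. x \<in> nonneg_orthant \<Longrightarrow> infdist x ?S \<le> c * norm (A *v x - A *v xbar)"
    using poisson_error_bound[OF opt feas(1)] by blast
  obtain B where B: "B > 0" "\<And>x. norm (A *v x) \<le> norm x * B"
    using bounded_linear.pos_bounded[OF matrix_vector_mul_bounded_linear[of A]] by blast
  \<comment> \<open>\<open>M\<close> bounds the coordinates of \<open>A x + A xbar\<close> for \<open>x\<close> in the ball.\<close>
  define M where "M = (2 * norm xbar + R) * B"
  have "M > 0"
    unfolding M_def using \<open>R > 0\<close> B(1) by (intro mult_pos_pos add_nonneg_pos) auto
  define \<beta> where "\<beta> = Min (range (\<lambda>i. b $ i))"
  have "\<beta> > 0"
    unfolding \<beta>_def using assms(3) by (subst Min_gr_iff) auto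
  have \<beta>: "\<beta> \<le> b $ i" for i
    unfolding \<beta>_def by (intro Min_le) auto
  define \<nu> where "\<nu> = \<beta> / (M * c)\<^sup>2"
  have "\<nu> > 0"
    using \<open>\<beta> > 0\<close> \<open>M > 0\<close> c(1) by (simp add: \<nu>_def)
  have growth: "ereal \<nu> * (set_distance x ?S)\<^sup>2 \<le> ?F x - ?F xbar" if x: "x \<in> cball xbar R" for x
  proof (cases "x \<in> nonneg_orthant \<and> (\<forall>i. 0 < (A *v x) $ i)")
    case False
    then have "?F x - ?F xbar = \<infinity>"
      using fin by (simp add: poisson_objective_infinite)
    then show ?thesis by simp
  next
    case True
    define u where "u = A *v x"
    define v where "v = A *v xbar"
    have pos: "0 < u $ i" "0 < v $ i" for i
      using True feas(2) by (auto simp: u_def v_def)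
    have "norm x \<le> norm xbar + R"
      using x norm_triangle_sub[of x xbar] by (simp add: dist_norm norm_minus_commute)
    then have "norm (x + xbar) * B \<le> M"
      unfolding M_def using B(1) norm_triangle_ineq[of x xbar] by (intro mult_right_mono) auto
    then have "norm (u + v) \<le> M"
      using B(2)[of "x + xbar"] by (simp add: u_def v_def matrix_vector_right_distrib)
    then have uv: "u $ i + v $ i \<le> M" for i
      using component_le_norm_cart[of "u + v" i] by simp
    have "\<nu> * (infdist x ?S)\<^sup>2 \<le> \<nu> * (c * norm (u - v))\<^sup>2"
      using c(2)[of x] True \<open>\<nu> > 0\<close>
      by (intro mult_left_mono power_mono) (auto simp: u_def v_def infdist_nonneg)
    also have "\<dots> = \<beta> / M\<^sup>2 * (norm (u - v))\<^sup>2"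
      using c(1) \<open>M > 0\<close> by (simp add: \<nu>_def power_mult_distrib)
    also have "(norm (u - v))\<^sup>2 = (\<Sum>i\<in>UNIV. (u $ i - v $ i)\<^sup>2)"
      unfolding norm_vec_def L2_set_def by (simp add: sum_nonneg)
    also have "\<beta> / M\<^sup>2 * \<dots> = (\<Sum>i\<in>UNIV. \<beta> * ((u $ i - v $ i)\<^sup>2 / M\<^sup>2))"
      by (simp add: sum_distrib_left)
    also have "\<dots> \<le> (\<Sum>i\<in>UNIV. b $ i * ((u $ i - v $ i) / (u $ i + v $ i))\<^sup>2)"
    proof (rule sum_mono)
      fix i
      have "(u $ i + v $ i)\<^sup>2 \<le> M\<^sup>2"
        using uv[of i] pos[of i] by (intro power_mono) auto
      then have "(u $ i - v $ i)\<^sup>2 / M\<^sup>2 \<le> (u $ i - v $ i)\<^sup>2 / (u $ i + v $ i)\<^sup>2"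
        using add_pos_pos[OF pos, of i i] \<open>M > 0\<close> by (intro divide_left_mono) auto
      then show "\<beta> * ((u $ i - v $ i)\<^sup>2 / M\<^sup>2) \<le> b $ i * ((u $ i - v $ i) / (u $ i + v $ i))\<^sup>2"
        using \<beta>[of i] \<open>\<beta> > 0\<close> unfolding power_divide by (intro mult_mono) auto
    qed
    finally have "ereal (\<nu> * (infdist x ?S)\<^sup>2)
        \<le> ereal (\<Sum>i\<in>UNIV. b $ i * ((u $ i - v $ i) / (u $ i + v $ i))\<^sup>2)"
      by simp
    also have "\<dots> \<le> ?F x - ?F xbar"
      using poisson_image_growth[OF assms(3) opt feas, of x] True by (simp add: u_def v_def)
    finally show ?thesis
      using opt by (subst set_distance_eq_infdist) auto
  qed
  moreover have "metrically_subregular (subdifferential ?F) xbar 0 (inverse \<nu>)"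
    using quadratic_growth_imp_metrically_subregular[OF opt fin \<open>\<nu> > 0\<close> \<open>R > 0\<close> growth] .
  ultimately show ?thesis
    using \<open>\<nu> > 0\<close> by blast
qed

end
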